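(* Let $G$ be a discrete $FC$-group. Then $G$ is a $WS$-group, i.e. $WS(G) = WAP(G)$, if and only if $G$ is a finite extension of its center $Z(G)$, i.e. $Z(G)$ has finite index in $G$.
   Context: A group is an $FC$-group if each of its conjugacy classes is finite. For a locally compact group $G$ (here discrete), $C(G)$ is the $C^*$-algebra of bounded continuous complex-valued functions on $G$ with the sup norm (so $C(G)=\ell^\infty(G)$ when $G$ is discrete). For $f\in C(G)$ and $x,y\in G$ put ${}_xf(z)=f(xz)$, $f_y(z)=f(zy)$, ${}_xf_y(z)=f(xzy)$. The left orbit is $O_L(f)=\{{}_xf:x\in G\}$ and the double orbit is $O(f)=\{{}_xf_y:x,y\in G\}$. $WAP(G)$ is the set of $f\in C(G)$ such that $O_L(f)$ is relatively weakly compact in $C(G)$ (equivalently, the right orbit $\{f_y : y\in G\}$ is). $WS(G)$ is the set of $f\in C(G)$ such that $O(f)$ is relatively weakly compact in $C(G)$. *)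

theory Defs
  imports "HOL-Analysis.Analysis" "HOL-Algebra.Coset"
begin

section \<open>Groups\<close>

definition conjugacy_class :: "('a, 'm) monoid_scheme \<Rightarrow> 'a \<Rightarrow> 'a set" where
  "conjugacy_class G x = {g \<otimes>\<^bsub>G\<^esub> x \<otimes>\<^bsub>G\<^esub> inv\<^bsub>G\<^esub> g | g. g \<in> carrier G}"

definition FC_group :: "('a, 'm) monoid_scheme \<Rightarrow> bool" where
  "FC_group G \<longleftrightarrow> group G \<and> (\<forall>x\<in>carrier G. finite (conjugacy_class G x))"

definition center :: "('a, 'm) monoid_scheme \<Rightarrow> 'a set" where
  "center G = {z \<in> carrier G. \<forall>x\<in>carrier G. z \<otimes>\<^bsub>G\<^esub> x = x \<otimes>\<^bsub>G\<^esub> z}"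

lemma (in group) subgroup_center: "subgroup (center G) G"
proof (rule subgroupI)
  show "center G \<subseteq> carrier G" by (auto simp: center_def)
  show "center G \<noteq> {}" by (auto simp: center_def)
next
  fix a assume "a \<in> center G"
  then have a: "a \<in> carrier G" and comm: "\<And>x. x \<in> carrier G \<Longrightarrow> a \<otimes> x = x \<otimes> a"
    by (auto simp: center_def)
  have "inv a \<otimes> x = x \<otimes> inv a" if x: "x \<in> carrier G" for x
  proof -
    have "a \<otimes> (x \<otimes> inv a) = x \<otimes> a \<otimes> inv a"
      using a x comm[OF x] by (simp add: m_assoc[symmetric])
    also have "\<dots> = x" using a x by (simp add: m_assoc)
    finally show ?thesis using a x by (simp add: inv_solve_left')
  qed
  with a show "inv a \<in> center G" by (auto simp: center_def)
next
  fix a b assume "a \<in> center G" "b \<in> center G"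
  then have a: "a \<in> carrier G" and b: "b \<in> carrier G"
    and ca: "\<And>x. x \<in> carrier G \<Longrightarrow> a \<otimes> x = x \<otimes> a"
    and cb: "\<And>x. x \<in> carrier G \<Longrightarrow> b \<otimes> x = x \<otimes> b"
    by (auto simp: center_def)
  have "a \<otimes> b \<otimes> x = x \<otimes> (a \<otimes> b)" if x: "x \<in> carrier G" for x
  proof -
    have "a \<otimes> b \<otimes> x = a \<otimes> (x \<otimes> b)" using a b x cb[OF x] by (simp add: m_assoc)
    also have "\<dots> = x \<otimes> a \<otimes> b" using a b x ca[OF x] by (simp add: m_assoc[symmetric])
    finally show ?thesis using a b x by (simp add: m_assoc)
  qed
  with a b show "a \<otimes> b \<in> center G" by (auto simp: center_def)
qed

section \<open>The Banach space of bounded functions on a discrete group and its weak topology\<close>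

text \<open>
  On a discrete group every function is continuous, so the bounded continuous functions are the
  bounded ones. Functions on the carrier are represented by total functions that are
  extensional, i.e. \<^const>\<open>undefined\<close> off the carrier, so that equality is
  equality on the carrier; accordingly all operations are restricted to the carrier.
\<close>

definition bounded_functions :: "('a, 'm) monoid_scheme \<Rightarrow> ('a \<Rightarrow> complex) set" where
  "bounded_functions G = {f \<in> extensional (carrier G). bounded (f ` carrier G)}"

definition sup_norm :: "('a, 'm) monoid_scheme \<Rightarrow> ('a \<Rightarrow> complex) \<Rightarrow> real" where
  "sup_norm G f = (SUP z\<in>carrier G. cmod (f z))"

text \<open>
  The continuous complex-linear functionals. Their values outside
  \<^const>\<open>bounded_functions\<close> are irrelevant.
\<close>

definition continuous_dual :: "('a, 'm) monoid_scheme \<Rightarrow> (('a \<Rightarrow> complex) \<Rightarrow> complex) set" where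
  "continuous_dual G = {\<phi>.
     (\<forall>f\<in>bounded_functions G. \<forall>g\<in>bounded_functions G.
        \<phi> (\<lambda>z\<in>carrier G. f z + g z) = \<phi> f + \<phi> g) \<and>
     (\<forall>c. \<forall>f\<in>bounded_functions G. \<phi> (\<lambda>z\<in>carrier G. c * f z) = c * \<phi> f) \<and>
     (\<exists>K. \<forall>f\<in>bounded_functions G. cmod (\<phi> f) \<le> K * sup_norm G f)}"

definition weak_topology :: "('a, 'm) monoid_scheme \<Rightarrow> ('a \<Rightarrow> complex) topology" where
  "weak_topology G = topology_generated_by
     {{f \<in> bounded_functions G. \<phi> f \<in> U} | \<phi> U. \<phi> \<in> continuous_dual G \<and> open U}"

lemma topspace_weak_topology: "topspace (weak_topology G) = bounded_functions G"
proof -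
  have "(\<lambda>_. 0) \<in> continuous_dual G"
    by (auto simp: continuous_dual_def intro!: exI[of _ 0])
  then have "bounded_functions G \<in>
      {{f \<in> bounded_functions G. \<phi> f \<in> U} | \<phi> U. \<phi> \<in> continuous_dual G \<and> open U}"
    by (intro CollectI exI[of _ "\<lambda>_. 0"] exI[of _ UNIV]) auto
  then show ?thesis
    unfolding weak_topology_def topology_generated_by_topspace by blast
qed

definition relatively_compactin :: "'b topology \<Rightarrow> 'b set \<Rightarrow> bool" where
  "relatively_compactin X S \<longleftrightarrow> S \<subseteq> topspace X \<and> compactin X (X closure_of S)"

section \<open>Orbits, WAP and WS\<close>

definition left_translate :: "('a, 'm) monoid_scheme \<Rightarrow> 'a \<Rightarrow> ('a \<Rightarrow> complex) \<Rightarrow> 'a \<Rightarrow> complex" where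
  "left_translate G x f = (\<lambda>z\<in>carrier G. f (x \<otimes>\<^bsub>G\<^esub> z))"

definition two_sided_translate ::
    "('a, 'm) monoid_scheme \<Rightarrow> 'a \<Rightarrow> 'a \<Rightarrow> ('a \<Rightarrow> complex) \<Rightarrow> 'a \<Rightarrow> complex" where
  "two_sided_translate G x y f = (\<lambda>z\<in>carrier G. f (x \<otimes>\<^bsub>G\<^esub> z \<otimes>\<^bsub>G\<^esub> y))"

definition left_orbit :: "('a, 'm) monoid_scheme \<Rightarrow> ('a \<Rightarrow> complex) \<Rightarrow> ('a \<Rightarrow> complex) set" where
  "left_orbit G f = {left_translate G x f | x. x \<in> carrier G}"

definition double_orbit :: "('a, 'm) monoid_scheme \<Rightarrow> ('a \<Rightarrow> complex) \<Rightarrow> ('a \<Rightarrow> complex) set" where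
  "double_orbit G f = {two_sided_translate G x y f | x y. x \<in> carrier G \<and> y \<in> carrier G}"

definition WAP :: "('a, 'm) monoid_scheme \<Rightarrow> ('a \<Rightarrow> complex) set" where
  "WAP G = {f \<in> bounded_functions G. relatively_compactin (weak_topology G) (left_orbit G f)}"

definition WS :: "('a, 'm) monoid_scheme \<Rightarrow> ('a \<Rightarrow> complex) set" where
  "WS G = {f \<in> bounded_functions G. relatively_compactin (weak_topology G) (double_orbit G f)}"

definition WS_group :: "('a, 'm) monoid_scheme \<Rightarrow> bool" where
  "WS_group G \<longleftrightarrow> WS G = WAP G"

end

theory Submission
  imports Defs
begin

text \<open>
  Suppose first that the center has finite index. If \<open>y = c t\<close> with \<open>c\<close> central, then
  \<open>f (x z y) = f ((x c) (z t))\<close>, so the double orbit of \<open>f\<close> is covered by finitely many right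
  translates of the left orbit. Right translation is weakly continuous, so relative weak compactness
  passes from the left orbit to the double orbit.

  Suppose now that the center has infinite index. The counterexample is the indicator \<open>f\<close> of a
  set \<open>A = {v 0, v 1, \<dots>}\<close>, chosen together with elements \<open>a n\<close> such that

  \<^item> \<open>a n\<close> commutes with \<open>v j\<close> exactly when \<open>j < n\<close>,
  \<^item> distinct members of \<open>A\<close> are not conjugate,
  \<^item> no \<open>v k\<close> has the form \<open>v i (v j)\<^sup>-\<^sup>1 v l\<close> with \<open>i, j, l < k\<close>.

  The elements in the first item exist because, in an FC-group whose center has infinite index, the
  centralizer of a finite set is never abelian: it has finite index, and a commutative one would make
  the center have finite index too. One can therefore pick pairs \<open>(a n, b n)\<close> successively, each
  failing to commute but commuting with everything picked before, and take the products
  \<open>b 0 \<dots> b m\<close>. The other two items hold after passing to a subsequence, since each term has to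
  avoid only finitely many elements: here finiteness of the conjugacy classes is used again.

  The third item makes \<open>A \<inter> t A\<close> and \<open>A \<inter> A t\<close> finite for every \<open>t \<noteq> 1\<close>. So the
  sets whose indicators make up the left orbit meet pairwise in finite sets, and two points lie in only
  finitely many of them. A continuous functional can be large on the indicators of only finitely many
  members of a disjoint family; it follows that such a left orbit, together with the indicators of
  points and \<open>0\<close>, is weakly compact (\<open>compactin_indicators\<close>).
  The first two items give \<open>f (a n v j (a n)\<^sup>-\<^sup>1) = 1\<close> if \<open>j < n\<close> and \<open>0\<close> otherwise.
  This matrix has different iterated limits, which Grothendieck's double limit criterion forbids for
  relatively weakly compact double orbits. The part of the criterion needed here is proved with a
  functional that takes limits along \<open>v\<close>: it vanishes on the conjugates of \<open>f\<close> by the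
  \<open>a n\<close>, but not on any bounded function that is constantly \<open>1\<close> on \<open>A\<close>, as every
  pointwise limit of these conjugates is (\<open>indicator_notin_WS\<close>).
\<close>

section \<open>Functionals on bounded functions\<close>

context group
begin

lemma cmod_le_sup_norm:
  assumes "f \<in> bounded_functions G" "z \<in> carrier G"
  shows "cmod (f z) \<le> sup_norm G f"
proof -
  have "bdd_above ((\<lambda>z. cmod (f z)) ` carrier G)"
    using assms(1) by (auto simp: bounded_functions_def bounded_iff bdd_above_def)
  then show ?thesis
    unfolding sup_norm_def using assms(2) by (rule cSUP_upper2) auto
qed

lemma sup_norm_le:
  assumes "\<And>z. z \<in> carrier G \<Longrightarrow> cmod (f z) \<le> M"
  shows "sup_norm G f \<le> M"
  unfolding sup_norm_def by (rule cSUP_least) (use assms in auto)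

lemma sup_norm_nonneg: "f \<in> bounded_functions G \<Longrightarrow> 0 \<le> sup_norm G f"
  using cmod_le_sup_norm[of f \<one>] norm_ge_zero[of "f \<one>"] by (metis one_closed order_trans)

lemma bounded_functionsI:
  assumes "\<And>z. z \<in> carrier G \<Longrightarrow> cmod (f z) \<le> M"
  shows "(\<lambda>z\<in>carrier G. f z) \<in> bounded_functions G"
  using assms by (auto simp: bounded_functions_def bounded_iff)

lemma bounded_functions_add:
  assumes "f \<in> bounded_functions G" "g \<in> bounded_functions G"
  shows "(\<lambda>z\<in>carrier G. f z + g z) \<in> bounded_functions G"
proof (rule bounded_functionsI)
  fix z assume "z \<in> carrier G"
  then show "cmod (f z + g z) \<le> sup_norm G f + sup_norm G g"
    by (intro norm_triangle_mono cmod_le_sup_norm assms)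
qed

lemma bounded_functions_scale:
  assumes "f \<in> bounded_functions G"
  shows "(\<lambda>z\<in>carrier G. c * f z) \<in> bounded_functions G"
proof (rule bounded_functionsI)
  fix z assume "z \<in> carrier G"
  then show "cmod (c * f z) \<le> cmod c * sup_norm G f"
    by (simp add: norm_mult mult_left_mono cmod_le_sup_norm assms)
qed

lemma dual_add:
  "\<phi> \<in> continuous_dual G \<Longrightarrow> f \<in> bounded_functions G \<Longrightarrow> g \<in> bounded_functions G \<Longrightarrow>
    \<phi> (\<lambda>z\<in>carrier G. f z + g z) = \<phi> f + \<phi> g"
  by (simp add: continuous_dual_def)

lemma dual_scale:
  "\<phi> \<in> continuous_dual G \<Longrightarrow> f \<in> bounded_functions G \<Longrightarrow>
    \<phi> (\<lambda>z\<in>carrier G. c * f z) = c * \<phi> f"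
  by (simp add: continuous_dual_def)

lemma dual_bound:
  assumes "\<phi> \<in> continuous_dual G"
  obtains K where "\<And>f. f \<in> bounded_functions G \<Longrightarrow> cmod (\<phi> f) \<le> K * sup_norm G f"
  using assms unfolding continuous_dual_def by blast

lemma dual_sum:
  assumes \<phi>: "\<phi> \<in> continuous_dual G" and "finite I"
    and "\<And>i. i \<in> I \<Longrightarrow> f i \<in> bounded_functions G"
  shows "(\<lambda>z\<in>carrier G. \<Sum>i\<in>I. c i * f i z) \<in> bounded_functions G \<and>
    \<phi> (\<lambda>z\<in>carrier G. \<Sum>i\<in>I. c i * f i z) = (\<Sum>i\<in>I. c i * \<phi> (f i))"
  using assms(2,3)
proof (induction I rule: finite_induct)
  case empty
  have 0: "(\<lambda>z\<in>carrier G. 0 :: complex) \<in> bounded_functions G"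
    by (rule bounded_functionsI[where M = 0]) simp
  have "\<phi> (\<lambda>z\<in>carrier G. 0 * (\<lambda>z\<in>carrier G. 0 :: complex) z) = 0 * \<phi> (\<lambda>z\<in>carrier G. 0)"
    by (rule dual_scale[OF \<phi> 0])
  with 0 show ?case by (simp add: restrict_def)
next
  case (insert i I)
  let ?g = "\<lambda>z\<in>carrier G. \<Sum>i\<in>I. c i * f i z" and ?h = "\<lambda>z\<in>carrier G. c i * f i z"
  have "?g \<in> bounded_functions G \<and> \<phi> ?g = (\<Sum>i\<in>I. c i * \<phi> (f i))"
    by (rule insert.IH) (use insert.prems in auto)
  then have g: "?g \<in> bounded_functions G" "\<phi> ?g = (\<Sum>i\<in>I. c i * \<phi> (f i))" by blast+
  have h: "?h \<in> bounded_functions G" "\<phi> ?h = c i * \<phi> (f i)"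
    using insert.prems by (auto intro: bounded_functions_scale dual_scale[OF \<phi>])
  have eq: "(\<lambda>z\<in>carrier G. \<Sum>i\<in>insert i I. c i * f i z) = (\<lambda>z\<in>carrier G. ?h z + ?g z)"
    using insert.hyps by (auto simp: restrict_def)
  show ?case
    using bounded_functions_add[OF h(1) g(1), folded eq] dual_add[OF \<phi> h(1) g(1), folded eq]
      g(2) h(2) sum.insert[OF insert.hyps, of "\<lambda>i. c i * \<phi> (f i)"]
    by (simp only: simp_thms)
qed

lemma evaluation_in_dual:
  assumes "z \<in> carrier G"
  shows "(\<lambda>f. f z) \<in> continuous_dual G"
  using assms cmod_le_sup_norm by (auto simp: continuous_dual_def intro!: exI[of _ 1])

section \<open>The weak topology\<close>

lemma openin_weak_preimage:
  "\<phi> \<in> continuous_dual G \<Longrightarrow> open U \<Longrightarrow> openin (weak_topology G) {f \<in> bounded_functions G. \<phi> f \<in> U}"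
  unfolding weak_topology_def by (rule topology_generated_by_Basis) blast

text \<open>
  The weak topology is generated by a subbase; this is the usual base of neighbourhoods of a point that
  comes from it.
\<close>

lemma weak_neighbourhood:
  assumes "openin (weak_topology G) W" "h \<in> W"
  shows "\<exists>\<Phi> \<epsilon>. finite \<Phi> \<and> \<Phi> \<subseteq> continuous_dual G \<and> \<epsilon> > 0 \<and>
    (\<forall>k\<in>bounded_functions G. (\<forall>\<phi>\<in>\<Phi>. cmod (\<phi> k - \<phi> h) < \<epsilon>) \<longrightarrow> k \<in> W)"
proof -
  have "generate_topology_on
      {{f \<in> bounded_functions G. \<phi> f \<in> U} | \<phi> U. \<phi> \<in> continuous_dual G \<and> open U} W"
    using assms(1) unfolding weak_topology_def by (rule openin_topology_generated_by)
  then show ?thesis using assms(2)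
  proof induction
    case (Int a b)
    from Int.IH(1) Int.prems obtain \<Phi> \<epsilon> where
      "finite \<Phi>" "\<Phi> \<subseteq> continuous_dual G" "\<epsilon> > 0"
      "\<forall>k\<in>bounded_functions G. (\<forall>\<phi>\<in>\<Phi>. cmod (\<phi> k - \<phi> h) < \<epsilon>) \<longrightarrow> k \<in> a"
      by blast
    moreover from Int.IH(2) Int.prems obtain \<Psi> \<delta> where
      "finite \<Psi>" "\<Psi> \<subseteq> continuous_dual G" "\<delta> > 0"
      "\<forall>k\<in>bounded_functions G. (\<forall>\<phi>\<in>\<Psi>. cmod (\<phi> k - \<phi> h) < \<delta>) \<longrightarrow> k \<in> b"
      by blast
    ultimately show ?case
      by (intro exI[of _ "\<Phi> \<union> \<Psi>"] exI[of _ "min \<epsilon> \<delta>"]) simp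
  next
    case (UN K)
    from UN.prems obtain k where k: "k \<in> K" "h \<in> k" by blast
    from UN.IH[OF k] obtain \<Phi> \<epsilon> where
      "finite \<Phi>" "\<Phi> \<subseteq> continuous_dual G" "\<epsilon> > 0"
      "\<forall>f\<in>bounded_functions G. (\<forall>\<phi>\<in>\<Phi>. cmod (\<phi> f - \<phi> h) < \<epsilon>) \<longrightarrow> f \<in> k"
      by blast
    with k(1) show ?case by (intro exI[of _ \<Phi>] exI[of _ \<epsilon>]) blast
  next
    case (Basis s)
    then obtain \<phi> U where s: "s = {f \<in> bounded_functions G. \<phi> f \<in> U}" "\<phi> \<in> continuous_dual G"
      and U: "open U" "\<phi> h \<in> U" by blast
    then obtain \<epsilon> where "\<epsilon> > 0" "ball (\<phi> h) \<epsilon> \<subseteq> U" using open_contains_ball by blast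
    with s show ?case
      by (intro exI[of _ "{\<phi>}"] exI[of _ \<epsilon>]) (auto simp: subset_iff dist_norm norm_minus_commute)
  qed simp
qed

lemma Hausdorff_weak_topology: "Hausdorff_space (weak_topology G)"
  unfolding Hausdorff_space_def topspace_weak_topology
proof (intro allI impI, elim conjE)
  fix f g assume f: "f \<in> bounded_functions G" and g: "g \<in> bounded_functions G" and "f \<noteq> g"
  then obtain z where z: "z \<in> carrier G" "f z \<noteq> g z"
    unfolding bounded_functions_def using extensionalityI[of f "carrier G" g] by blast
  then obtain U V where "open U" "open V" "f z \<in> U" "g z \<in> V" "U \<inter> V = {}"
    using hausdorff by metis
  with f g z(1) show "\<exists>U V. openin (weak_topology G) U \<and> openin (weak_topology G) V \<and>
      f \<in> U \<and> g \<in> V \<and> disjnt U V"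
    by (intro exI[of _ "{f \<in> bounded_functions G. f z \<in> U}"]
        exI[of _ "{f \<in> bounded_functions G. f z \<in> V}"] conjI)
      (auto intro!: openin_weak_preimage evaluation_in_dual simp: disjnt_iff)
qed

text \<open>
  Compact sets are closed because the topology is Hausdorff, so a closure need never be computed: it is
  enough to exhibit some compact superset.
\<close>

lemma relatively_weakly_compact_iff:
  "relatively_compactin (weak_topology G) S \<longleftrightarrow> (\<exists>K. compactin (weak_topology G) K \<and> S \<subseteq> K)"
proof
  assume "relatively_compactin (weak_topology G) S"
  then show "\<exists>K. compactin (weak_topology G) K \<and> S \<subseteq> K"
    unfolding relatively_compactin_def using closure_of_subset by blast
next
  assume "\<exists>K. compactin (weak_topology G) K \<and> S \<subseteq> K"
  then obtain K where K: "compactin (weak_topology G) K" "S \<subseteq> K" by blast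
  then have "closedin (weak_topology G) K"
    using compactin_imp_closedin Hausdorff_weak_topology by blast
  then have "weak_topology G closure_of S \<subseteq> K" using K(2) by (rule closure_of_minimal[rotated])
  then show "relatively_compactin (weak_topology G) S"
    unfolding relatively_compactin_def
    using K closed_compactin closedin_closure_of compactin_subset_topspace by (metis subset_trans)
qed

lemma two_sided_translate_bounded:
  assumes "f \<in> bounded_functions G" "x \<in> carrier G" "y \<in> carrier G"
  shows "two_sided_translate G x y f \<in> bounded_functions G"
  unfolding two_sided_translate_def
  by (rule bounded_functionsI[where M = "sup_norm G f"]) (use assms in \<open>auto intro: cmod_le_sup_norm\<close>)

lemma dual_two_sided_translate:
  assumes \<phi>: "\<phi> \<in> continuous_dual G" and x: "x \<in> carrier G" and y: "y \<in> carrier G"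
  shows "(\<lambda>f. \<phi> (two_sided_translate G x y f)) \<in> continuous_dual G"
proof -
  let ?T = "two_sided_translate G x y"
  have "?T (\<lambda>z\<in>carrier G. f z + g z) = (\<lambda>z\<in>carrier G. ?T f z + ?T g z)" for f g
    using x y by (auto simp: two_sided_translate_def restrict_def)
  moreover have "?T (\<lambda>z\<in>carrier G. c * f z) = (\<lambda>z\<in>carrier G. c * ?T f z)" for f c
    using x y by (auto simp: two_sided_translate_def restrict_def)
  moreover have "\<exists>K. \<forall>f\<in>bounded_functions G. cmod (\<phi> (?T f)) \<le> K * sup_norm G f"
  proof -
    obtain K where K: "\<And>f. f \<in> bounded_functions G \<Longrightarrow> cmod (\<phi> f) \<le> K * sup_norm G f"
      using dual_bound[OF \<phi>] by blast
    have "cmod (\<phi> (?T f)) \<le> \<bar>K\<bar> * sup_norm G f" if f: "f \<in> bounded_functions G" for f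
    proof -
      have Tf: "?T f \<in> bounded_functions G" by (rule two_sided_translate_bounded[OF f x y])
      have "sup_norm G (?T f) \<le> sup_norm G f"
        by (rule sup_norm_le) (use f x y in \<open>auto simp: two_sided_translate_def intro: cmod_le_sup_norm\<close>)
      then have "\<bar>K\<bar> * sup_norm G (?T f) \<le> \<bar>K\<bar> * sup_norm G f" by (simp add: mult_left_mono)
      moreover have "K * sup_norm G (?T f) \<le> \<bar>K\<bar> * sup_norm G (?T f)"
        using sup_norm_nonneg[OF Tf] by (simp add: mult_right_mono)
      ultimately show ?thesis using K[OF Tf] by linarith
    qed
    then show ?thesis by blast
  qed
  ultimately show ?thesis
    using two_sided_translate_bounded[OF _ x y] \<phi> by (auto simp: continuous_dual_def)
qed

lemma continuous_map_two_sided_translate: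
  assumes x: "x \<in> carrier G" and y: "y \<in> carrier G"
  shows "continuous_map (weak_topology G) (weak_topology G) (two_sided_translate G x y)"
proof -
  let ?T = "two_sided_translate G x y"
  have "openin (weak_topology G) (?T -` {f \<in> bounded_functions G. \<phi> f \<in> U} \<inter> bounded_functions G)"
    if "\<phi> \<in> continuous_dual G" "open U" for \<phi> U
  proof -
    have "?T -` {f \<in> bounded_functions G. \<phi> f \<in> U} \<inter> bounded_functions G =
        {f \<in> bounded_functions G. \<phi> (?T f) \<in> U}"
      using two_sided_translate_bounded[OF _ x y] by auto
    then show ?thesis
      using openin_weak_preimage[OF dual_two_sided_translate[OF that(1) x y] that(2)] by simp
  qed
  moreover have "\<Union> {{f \<in> bounded_functions G. \<phi> f \<in> U} | \<phi> U. \<phi> \<in> continuous_dual G \<and> open U} =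
      bounded_functions G"
    using topspace_weak_topology[of G] unfolding weak_topology_def topology_generated_by_topspace .
  moreover have "?T ` bounded_functions G \<subseteq> bounded_functions G"
    using two_sided_translate_bounded[OF _ x y] by blast
  ultimately have "continuous_map (weak_topology G) (topology_generated_by
      {{f \<in> bounded_functions G. \<phi> f \<in> U} | \<phi> U. \<phi> \<in> continuous_dual G \<and> open U}) ?T"
    by (intro continuous_on_generated_topo) (auto simp: topspace_weak_topology)
  then show ?thesis by (fold weak_topology_def)
qed

section \<open>Weakly compact families of indicator functions\<close>

definition ind :: "'a set \<Rightarrow> 'a \<Rightarrow> complex" where
  "ind E = (\<lambda>z\<in>carrier G. if z \<in> E then 1 else 0)"

lemma ind_bounded: "ind E \<in> bounded_functions G"
  unfolding ind_def by (rule bounded_functionsI[where M = 1]) simp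

lemma dual_ind_Un:
  assumes "\<phi> \<in> continuous_dual G" "D \<inter> E = {}"
  shows "\<phi> (ind (D \<union> E)) = \<phi> (ind D) + \<phi> (ind E)"
proof -
  have "ind (D \<union> E) = (\<lambda>z\<in>carrier G. ind D z + ind E z)"
    using assms(2) by (intro ext) (auto simp: ind_def restrict_def)
  then show ?thesis using dual_add[OF assms(1) ind_bounded ind_bounded] by simp
qed

lemma dual_ind_empty: "\<phi> \<in> continuous_dual G \<Longrightarrow> \<phi> (ind {}) = 0"
  using dual_ind_Un[of \<phi> "{}" "{}"] by simp

text \<open>
  Adding up the indicators with unimodular coefficients that cancel the phases of the values of
  \<open>\<phi>\<close> gives a function of norm at most 1, because the sets are disjoint, at which
  \<open>\<phi>\<close> is the sum of the absolute values.
\<close>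

lemma card_disjoint_large_le:
  assumes \<phi>: "\<phi> \<in> continuous_dual G"
    and K: "\<And>f. f \<in> bounded_functions G \<Longrightarrow> cmod (\<phi> f) \<le> K * sup_norm G f"
    and I: "finite I" and disj: "disjoint_family_on D I"
    and large: "\<And>i. i \<in> I \<Longrightarrow> \<epsilon> \<le> cmod (\<phi> (ind (D i)))"
  shows "real (card I) * \<epsilon> \<le> \<bar>K\<bar>"
proof -
  define c where "c i = cnj (sgn (\<phi> (ind (D i))))" for i
  have c: "c i * \<phi> (ind (D i)) = cmod (\<phi> (ind (D i)))" for i
  proof -
    have "c i * \<phi> (ind (D i)) = (\<phi> (ind (D i)) * cnj (\<phi> (ind (D i)))) / cmod (\<phi> (ind (D i)))"
      by (simp add: c_def sgn_eq)
    also have "\<dots> = cmod (\<phi> (ind (D i)))"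
      unfolding complex_norm_square[symmetric] by (simp add: power2_eq_square)
    finally show ?thesis .
  qed
  let ?h = "\<lambda>z\<in>carrier G. \<Sum>i\<in>I. c i * ind (D i) z"
  have h: "?h \<in> bounded_functions G" "\<phi> ?h = (\<Sum>i\<in>I. c i * \<phi> (ind (D i)))"
    using dual_sum[OF \<phi> I, of "\<lambda>i. ind (D i)" c] ind_bounded by auto
  have "cmod (?h z) \<le> 1" if z: "z \<in> carrier G" for z
  proof (cases "\<exists>i\<in>I. z \<in> D i")
    case True
    then obtain i where i: "i \<in> I" "z \<in> D i" by blast
    have "(\<Sum>j\<in>I. c j * ind (D j) z) = (\<Sum>j\<in>I. if j = i then c i else 0)"
      using disj i z by (intro sum.cong) (auto simp: ind_def disjoint_family_on_def)
    then show ?thesis using z i I by (simp add: c_def norm_sgn)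
  next
    case False
    then have "(\<Sum>j\<in>I. c j * ind (D j) z) = 0" using z by (intro sum.neutral) (auto simp: ind_def)
    then show ?thesis using z by simp
  qed
  then have "sup_norm G ?h \<le> 1" by (rule sup_norm_le)
  then have "K * sup_norm G ?h \<le> \<bar>K\<bar> * 1"
    using sup_norm_nonneg[OF h(1)] by (intro mult_mono) auto
  then have "cmod (\<phi> ?h) \<le> \<bar>K\<bar>" using K[OF h(1)] by linarith
  moreover have "\<phi> ?h = complex_of_real (\<Sum>i\<in>I. cmod (\<phi> (ind (D i))))" using h(2) c by simp
  ultimately have "(\<Sum>i\<in>I. cmod (\<phi> (ind (D i)))) \<le> \<bar>K\<bar>"
    by (simp add: abs_of_nonneg sum_nonneg flip: of_real_sum)
  moreover have "real (card I) * \<epsilon> \<le> (\<Sum>i\<in>I. cmod (\<phi> (ind (D i))))"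
    using sum_bounded_below[of I \<epsilon> "\<lambda>i. cmod (\<phi> (ind (D i)))"] large by simp
  ultimately show ?thesis by linarith
qed

text \<open>
  The union of a disjoint family of finite sets with large \<open>\<phi>\<close> works if the family has
  the greatest possible number of members; such a family exists by the bound on disjoint families.
\<close>

lemma dual_small_off_finite_set:
  assumes \<phi>: "\<phi> \<in> continuous_dual G" and \<epsilon>: "\<epsilon> > 0"
  obtains F where "finite F" "\<And>E. finite E \<Longrightarrow> E \<inter> F = {} \<Longrightarrow> cmod (\<phi> (ind E)) < \<epsilon>"
proof -
  obtain K where K: "\<And>f. f \<in> bounded_functions G \<Longrightarrow> cmod (\<phi> f) \<le> K * sup_norm G f"
    using dual_bound[OF \<phi>] by blast
  define P where "P \<E> \<longleftrightarrow> finite \<E> \<and> disjoint_family_on id \<E> \<and>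
    (\<forall>E\<in>\<E>. finite E \<and> \<epsilon> \<le> cmod (\<phi> (ind E)))" for \<E>
  have "card \<E> < nat \<lceil>\<bar>K\<bar> / \<epsilon>\<rceil> + 1" if "P \<E>" for \<E>
  proof -
    have "real (card \<E>) * \<epsilon> \<le> \<bar>K\<bar>"
      using that by (intro card_disjoint_large_le[OF \<phi> K, of \<E> id]) (auto simp: P_def)
    then have "real (card \<E>) \<le> \<bar>K\<bar> / \<epsilon>" using \<epsilon> by (simp add: field_simps)
    then show ?thesis by linarith
  qed
  moreover have "P {}" by (simp add: P_def disjoint_family_on_def)
  ultimately obtain \<E> where \<E>: "P \<E>" and max: "\<And>\<E>'. P \<E>' \<Longrightarrow> card \<E>' \<le> card \<E>"
    using ex_has_greatest_nat[of P "{}" card] by blast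
  show thesis
  proof (rule that[of "\<Union>\<E>"])
    show "finite (\<Union>\<E>)" using \<E> by (auto simp: P_def)
    fix E :: "'a set" assume E: "finite E" "E \<inter> \<Union>\<E> = {}"
    show "cmod (\<phi> (ind E)) < \<epsilon>"
    proof (rule ccontr)
      assume large: "\<not> cmod (\<phi> (ind E)) < \<epsilon>"
      then have "E \<noteq> {}" using dual_ind_empty[OF \<phi>] \<epsilon> by auto
      then have "E \<notin> \<E>" using E(2) by blast
      moreover have "P (insert E \<E>)"
        using \<E> E large by (auto simp: P_def disjoint_family_on_def)
      ultimately show False using max[of "insert E \<E>"] \<E> by (simp add: P_def)
    qed
  qed
qed

definition almost_disjoint :: "'a set set \<Rightarrow> bool" where
  "almost_disjoint \<D> \<longleftrightarrow> (\<forall>D\<in>\<D>. \<forall>E\<in>\<D>. D \<noteq> E \<longrightarrow> finite (D \<inter> E))"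

text \<open>
  An almost disjoint family becomes disjoint when a finite set is removed from finitely many of its
  members. If the members avoid \<open>F\<close>, so does the removed set, and its removal changes the value
  of \<open>\<phi>\<close> by little. The set \<open>F\<close> has to be chosen before the family: in
  \<open>compactin_indicators\<close> the members that do meet it are treated separately.
\<close>

lemma finitely_many_large:
  assumes \<phi>: "\<phi> \<in> continuous_dual G" and \<epsilon>: "\<epsilon> > 0"
  shows "\<exists>F. finite F \<and> (\<forall>\<D>. almost_disjoint \<D> \<longrightarrow>
    finite {D \<in> \<D>. D \<inter> F = {} \<and> \<epsilon> \<le> cmod (\<phi> (ind D))})"
proof -
  obtain K where K: "\<And>f. f \<in> bounded_functions G \<Longrightarrow> cmod (\<phi> f) \<le> K * sup_norm G f"
    using dual_bound[OF \<phi>] by blast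
  obtain F where F: "finite F" "\<And>E. finite E \<Longrightarrow> E \<inter> F = {} \<Longrightarrow> cmod (\<phi> (ind E)) < \<epsilon> / 2"
    using dual_small_off_finite_set[OF \<phi>, of "\<epsilon> / 2"] \<epsilon> by auto
  show ?thesis
  proof (intro exI[of _ F] conjI allI impI F(1))
    fix \<D> assume ad: "almost_disjoint \<D>"
    show "finite {D \<in> \<D>. D \<inter> F = {} \<and> \<epsilon> \<le> cmod (\<phi> (ind D))}"
    proof (rule ccontr)
      assume inf: "infinite {D \<in> \<D>. D \<inter> F = {} \<and> \<epsilon> \<le> cmod (\<phi> (ind D))}"
      obtain \<C> where \<C>: "\<C> \<subseteq> {D \<in> \<D>. D \<inter> F = {} \<and> \<epsilon> \<le> cmod (\<phi> (ind D))}" "finite \<C>"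
        and card: "card \<C> = nat \<lceil>2 * \<bar>K\<bar> / \<epsilon>\<rceil> + 1"
        using infinite_arbitrarily_large[OF inf, of "nat \<lceil>2 * \<bar>K\<bar> / \<epsilon>\<rceil> + 1"] by auto
      define X where "X = (\<Union>D\<in>\<C>. \<Union>E\<in>\<C> - {D}. D \<inter> E)"
      have X: "finite X"
        unfolding X_def
      proof (intro finite_UN_I)
        fix D E assume "D \<in> \<C>" "E \<in> \<C> - {D}"
        then show "finite (D \<inter> E)" using \<C>(1) ad unfolding almost_disjoint_def by blast
      qed (use \<C>(2) in auto)
      have "\<epsilon> / 2 \<le> cmod (\<phi> (ind (D - X)))" if D: "D \<in> \<C>" for D
      proof -
        have "\<phi> (ind D) = \<phi> (ind (D - X)) + \<phi> (ind (D \<inter> X))"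
          using dual_ind_Un[OF \<phi>, of "D - X" "D \<inter> X"] by (metis Int_Diff_disjoint Un_Diff_Int inf_commute)
        moreover have "cmod (\<phi> (ind (D \<inter> X))) < \<epsilon> / 2" using X D \<C> by (intro F(2)) auto
        moreover have "\<epsilon> \<le> cmod (\<phi> (ind D))" using D \<C> by auto
        ultimately show ?thesis
          using norm_triangle_ineq[of "\<phi> (ind (D - X))" "\<phi> (ind (D \<inter> X))"] by simp
      qed
      moreover have "disjoint_family_on (\<lambda>D. D - X) \<C>"
        by (auto simp: disjoint_family_on_def X_def)
      ultimately have "real (card \<C>) * (\<epsilon> / 2) \<le> \<bar>K\<bar>"
        by (intro card_disjoint_large_le[OF \<phi> K \<C>(2)])
      then have "real (card \<C>) \<le> 2 * \<bar>K\<bar> / \<epsilon>" using \<epsilon> by (simp add: field_simps)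
      then show False using card by linarith
    qed
  qed
qed

lemma finitely_many_outside_neighbourhood_of_zero:
  assumes "openin (weak_topology G) W" "ind {} \<in> W"
  shows "\<exists>F. finite F \<and> (\<forall>\<D>. almost_disjoint \<D> \<longrightarrow> finite {D \<in> \<D>. D \<inter> F = {} \<and> ind D \<notin> W})"
proof -
  obtain \<Phi> \<epsilon> where \<Phi>: "finite \<Phi>" "\<Phi> \<subseteq> continuous_dual G" "\<epsilon> > 0"
    and W: "\<forall>k\<in>bounded_functions G. (\<forall>\<phi>\<in>\<Phi>. cmod (\<phi> k - \<phi> (ind {})) < \<epsilon>) \<longrightarrow> k \<in> W"
    using weak_neighbourhood[OF assms] by blast
  have "\<forall>\<phi>\<in>\<Phi>. \<exists>F. finite F \<and> (\<forall>\<D>. almost_disjoint \<D> \<longrightarrow>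
      finite {D \<in> \<D>. D \<inter> F = {} \<and> \<epsilon> \<le> cmod (\<phi> (ind D))})"
    using finitely_many_large[OF _ \<Phi>(3)] \<Phi>(2) by blast
  from bchoice[OF this] obtain F where F: "\<And>\<phi>. \<phi> \<in> \<Phi> \<Longrightarrow> finite (F \<phi>)"
    "\<And>\<phi> \<D>. \<phi> \<in> \<Phi> \<Longrightarrow> almost_disjoint \<D> \<Longrightarrow>
      finite {D \<in> \<D>. D \<inter> F \<phi> = {} \<and> \<epsilon> \<le> cmod (\<phi> (ind D))}"
    by blast
  show ?thesis
  proof (intro exI[of _ "\<Union>\<phi>\<in>\<Phi>. F \<phi>"] conjI allI impI)
    show "finite (\<Union>\<phi>\<in>\<Phi>. F \<phi>)" using F(1) \<Phi>(1) by auto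
    fix \<D> :: "'a set set" assume ad: "almost_disjoint \<D>"
    have "{D \<in> \<D>. D \<inter> (\<Union>\<phi>\<in>\<Phi>. F \<phi>) = {} \<and> ind D \<notin> W} \<subseteq>
        (\<Union>\<phi>\<in>\<Phi>. {D \<in> \<D>. D \<inter> F \<phi> = {} \<and> \<epsilon> \<le> cmod (\<phi> (ind D))})"
    proof
      fix D assume D: "D \<in> {D \<in> \<D>. D \<inter> (\<Union>\<phi>\<in>\<Phi>. F \<phi>) = {} \<and> ind D \<notin> W}"
      then obtain \<phi> where "\<phi> \<in> \<Phi>" "\<not> cmod (\<phi> (ind D) - \<phi> (ind {})) < \<epsilon>"
        using W ind_bounded by blast
      moreover from this have "\<phi> (ind {}) = 0" using \<Phi>(2) by (intro dual_ind_empty) blast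
      ultimately show "D \<in> (\<Union>\<phi>\<in>\<Phi>. {D \<in> \<D>. D \<inter> F \<phi> = {} \<and> \<epsilon> \<le> cmod (\<phi> (ind D))})"
        using D by (intro UN_I[of \<phi>]) auto
    qed
    then show "finite {D \<in> \<D>. D \<inter> (\<Union>\<phi>\<in>\<Phi>. F \<phi>) = {} \<and> ind D \<notin> W}"
      by (rule finite_subset) (use F(2) ad \<Phi>(1) in auto)
  qed
qed

text \<open>
  Relative to the indicator of \<open>g\<close>, a member containing \<open>g\<close> differs by the
  indicator of the member without \<open>g\<close>. These smaller sets are again almost disjoint, and the
  last hypothesis says that each remaining point belongs to only finitely many of them. So all but
  finitely many avoid any given finite set.
\<close>

lemma finitely_many_outside_neighbourhood_of_point:
  assumes "openin (weak_topology G) W" "ind {g} \<in> W" and ad: "almost_disjoint \<D>"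
    and fin: "\<And>h. g \<noteq> h \<Longrightarrow> finite {D \<in> \<D>. g \<in> D \<and> h \<in> D}"
  shows "finite {D \<in> \<D>. g \<in> D \<and> ind D \<notin> W}"
proof -
  obtain \<Phi> \<epsilon> where \<Phi>: "finite \<Phi>" "\<Phi> \<subseteq> continuous_dual G" "\<epsilon> > 0"
    and W: "\<forall>k\<in>bounded_functions G. (\<forall>\<phi>\<in>\<Phi>. cmod (\<phi> k - \<phi> (ind {g})) < \<epsilon>) \<longrightarrow> k \<in> W"
    using weak_neighbourhood[OF assms(1,2)] by blast
  have "finite {D \<in> \<D>. g \<in> D \<and> \<epsilon> \<le> cmod (\<phi> (ind (D - {g})))}" if "\<phi> \<in> \<Phi>" for \<phi>
  proof -
    obtain F where F: "finite F" "\<And>\<D>. almost_disjoint \<D> \<Longrightarrow>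
        finite {D \<in> \<D>. D \<inter> F = {} \<and> \<epsilon> \<le> cmod (\<phi> (ind D))}"
      using finitely_many_large[OF _ \<Phi>(3)] \<Phi>(2) \<open>\<phi> \<in> \<Phi>\<close> by blast
    let ?\<D> = "(\<lambda>D. D - {g}) ` {D \<in> \<D>. g \<in> D}"
    have "almost_disjoint ?\<D>"
      unfolding almost_disjoint_def
    proof (intro ballI impI)
      fix A B assume "A \<in> ?\<D>" "B \<in> ?\<D>" "A \<noteq> B"
      then obtain D E where DE: "D \<in> \<D>" "E \<in> \<D>" "D \<noteq> E" "A = D - {g}" "B = E - {g}" by blast
      then have "finite (D \<inter> E)" using ad unfolding almost_disjoint_def by blast
      moreover have "A \<inter> B \<subseteq> D \<inter> E" using DE by blast
      ultimately show "finite (A \<inter> B)" by (rule rev_finite_subset)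
    qed
    then have *: "finite {D \<in> ?\<D>. D \<inter> F = {} \<and> \<epsilon> \<le> cmod (\<phi> (ind D))}" by (rule F(2))
    have sub: "{D \<in> \<D>. g \<in> D \<and> \<epsilon> \<le> cmod (\<phi> (ind (D - {g})))} \<subseteq>
        insert g ` {D \<in> ?\<D>. D \<inter> F = {} \<and> \<epsilon> \<le> cmod (\<phi> (ind D))} \<union>
        (\<Union>h\<in>F - {g}. {D \<in> \<D>. g \<in> D \<and> h \<in> D})"
    proof
      fix D assume D: "D \<in> {D \<in> \<D>. g \<in> D \<and> \<epsilon> \<le> cmod (\<phi> (ind (D - {g})))}"
      then have "D = insert g (D - {g})" by blast
      then show "D \<in> insert g ` {D \<in> ?\<D>. D \<inter> F = {} \<and> \<epsilon> \<le> cmod (\<phi> (ind D))} \<union>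
        (\<Union>h\<in>F - {g}. {D \<in> \<D>. g \<in> D \<and> h \<in> D})"
        using D by (cases "(D - {g}) \<inter> F = {}") (blast, blast)
    qed
    have "finite {D \<in> \<D>. g \<in> D \<and> h \<in> D}" if "h \<in> F - {g}" for h
      using fin[of h] that by blast
    then have "finite (insert g ` {D \<in> ?\<D>. D \<inter> F = {} \<and> \<epsilon> \<le> cmod (\<phi> (ind D))} \<union>
        (\<Union>h\<in>F - {g}. {D \<in> \<D>. g \<in> D \<and> h \<in> D}))"
      using F(1) by (intro finite_UnI finite_imageI * finite_UN_I finite_Diff)
    with sub show ?thesis by (rule finite_subset)
  qed
  then have "finite (\<Union>\<phi>\<in>\<Phi>. {D \<in> \<D>. g \<in> D \<and> \<epsilon> \<le> cmod (\<phi> (ind (D - {g})))})"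
    using \<Phi>(1) by auto
  moreover have "{D \<in> \<D>. g \<in> D \<and> ind D \<notin> W} \<subseteq>
      (\<Union>\<phi>\<in>\<Phi>. {D \<in> \<D>. g \<in> D \<and> \<epsilon> \<le> cmod (\<phi> (ind (D - {g})))})"
  proof
    fix D assume D: "D \<in> {D \<in> \<D>. g \<in> D \<and> ind D \<notin> W}"
    then obtain \<phi> where \<phi>: "\<phi> \<in> \<Phi>" "\<not> cmod (\<phi> (ind D) - \<phi> (ind {g})) < \<epsilon>"
      using W ind_bounded by blast
    have "\<phi> (ind D) = \<phi> (ind {g}) + \<phi> (ind (D - {g}))"
      using dual_ind_Un[of \<phi> "{g}" "D - {g}"] \<phi> \<Phi>(2) D by (auto simp: insert_absorb)
    then show "D \<in> (\<Union>\<phi>\<in>\<Phi>. {D \<in> \<D>. g \<in> D \<and> \<epsilon> \<le> cmod (\<phi> (ind (D - {g})))})"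
      using D \<phi> by (intro UN_I[of \<phi>]) auto
  qed
  ultimately show ?thesis by (rule rev_finite_subset)
qed

text \<open>
  A member of an open cover containing \<open>0\<close> contains the indicators of all but finitely many
  of the sets in \<open>\<D>\<close> that avoid a certain finite set \<open>F\<close>. The sets that contain a
  point \<open>g\<close> of \<open>F\<close> accumulate only at the indicator of \<open>g\<close>, so members of the
  cover around these finitely many further functions leave only finitely many functions uncovered.
\<close>

proposition compactin_indicators:
  assumes ad: "almost_disjoint \<D>"
    and fin: "\<And>g h. g \<noteq> h \<Longrightarrow> finite {D \<in> \<D>. g \<in> D \<and> h \<in> D}"
  shows "compactin (weak_topology G) (insert (ind {}) (range (\<lambda>g. ind {g}) \<union> ind ` \<D>))"
    (is "compactin _ ?K")
  unfolding compactin_def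
proof (intro conjI allI impI, goal_cases)
  case 1
  show ?case using ind_bounded by (auto simp: topspace_weak_topology)
next
  case (2 \<U>)
  then have "\<U> \<subseteq> Collect (openin (weak_topology G))" and cover: "?K \<subseteq> \<Union>\<U>" by auto
  then have op: "openin (weak_topology G) U" if "U \<in> \<U>" for U using that by blast
  obtain W0 where W0: "W0 \<in> \<U>" "ind {} \<in> W0" using cover by blast
  obtain F where F: "finite F" "\<forall>\<D>. almost_disjoint \<D> \<longrightarrow>
      finite {D \<in> \<D>. D \<inter> F = {} \<and> ind D \<notin> W0}"
    using finitely_many_outside_neighbourhood_of_zero[OF op[OF W0(1)] W0(2)] by blast
  have "\<forall>g. \<exists>W\<in>\<U>. ind {g} \<in> W" using cover by blast
  then obtain W where W: "\<And>g. W g \<in> \<U>" "\<And>g. ind {g} \<in> W g" by metis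
  define \<R> where "\<R> = {D \<in> range (\<lambda>g. {g}). D \<inter> F = {} \<and> ind D \<notin> W0} \<union>
    {D \<in> \<D>. D \<inter> F = {} \<and> ind D \<notin> W0} \<union> (\<Union>g\<in>F. {D \<in> \<D>. g \<in> D \<and> ind D \<notin> W g})"
  have "almost_disjoint (range (\<lambda>g. {g}))" by (auto simp: almost_disjoint_def)
  then have fin1: "finite {D \<in> range (\<lambda>g. {g}). D \<inter> F = {} \<and> ind D \<notin> W0}"
    using F(2) by blast
  have fin2: "finite {D \<in> \<D>. D \<inter> F = {} \<and> ind D \<notin> W0}"
    using F(2) ad by blast
  have "finite {D \<in> \<D>. g \<in> D \<and> ind D \<notin> W g}" for g
    using op[OF W(1)] W(2) ad fin by (rule finitely_many_outside_neighbourhood_of_point)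
  with F(1) have fin3: "finite (\<Union>g\<in>F. {D \<in> \<D>. g \<in> D \<and> ind D \<notin> W g})"
    by (rule finite_UN_I)
  have "finite \<R>"
    unfolding \<R>_def by (rule finite_UnI[OF finite_UnI[OF fin1 fin2] fin3])
  have "\<R> \<subseteq> range (\<lambda>g. {g}) \<union> \<D>" unfolding \<R>_def by auto
  then have "ind D \<in> \<Union>\<U>" if "D \<in> \<R>" for D
    using that by (intro subsetD[OF cover]) auto
  then have "\<forall>D\<in>\<R>. \<exists>V. V \<in> \<U> \<and> ind D \<in> V" by blast
  from bchoice[OF this] obtain V where V: "\<And>D. D \<in> \<R> \<Longrightarrow> V D \<in> \<U>" "\<And>D. D \<in> \<R> \<Longrightarrow> ind D \<in> V D"
    by blast
  let ?\<V> = "insert W0 (W ` F \<union> V ` \<R>)"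
  have "?K \<subseteq> \<Union>?\<V>"
  proof
    fix k assume "k \<in> ?K"
    then consider "k = ind {}" | g where "k = ind {g}" | D where "D \<in> \<D>" "k = ind D" by blast
    then show "k \<in> \<Union>?\<V>"
    proof cases
      case 1
      then show ?thesis using W0(2) by simp
    next
      case (2 g)
      show ?thesis
      proof (cases "g \<in> F \<or> ind {g} \<in> W0")
        case True
        then show ?thesis using 2 W(2)[of g] by auto
      next
        case False
        then have "{g} \<in> \<R>" by (simp add: \<R>_def)
        then show ?thesis using 2 V(2) by auto
      qed
    next
      case (3 D)
      show ?thesis
      proof (cases "ind D \<in> W0 \<or> (\<exists>g\<in>F. ind D \<in> W g)")
        case True
        then show ?thesis using 3 by auto
      next
        case False
        then have "D \<in> \<R>" using 3 by (cases "D \<inter> F = {}") (auto simp: \<R>_def)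
        then show ?thesis using 3 V(2) by auto
      qed
    qed
  qed
  moreover have "finite ?\<V>" "?\<V> \<subseteq> \<U>" using F(1) \<open>finite \<R>\<close> W0 W(1) V(1) by auto
  ultimately show ?case by blast
qed

end

section \<open>Limits along universal filters\<close>

text \<open>
  The evaluations at the natural numbers lie in a product of compact sets, one for each bounded
  sequence. A cluster point \<open>p\<close> of them, which exists by Tychonoff's theorem, assigns a
  generalized limit to each bounded sequence, and \<open>\<F>\<close> is the trace of its neighbourhoods.
\<close>

lemma universal_filter_exists:
  "\<exists>\<F>. \<F> \<noteq> bot \<and> \<F> \<le> sequentially \<and>
    (\<forall>s :: nat \<Rightarrow> complex. bounded (range s) \<longrightarrow> (\<exists>l. (s \<longlongrightarrow> l) \<F>))"
proof -
  \<comment> \<open>The value at unbounded sequences only has to stay in a compact set.\<close>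
  define e :: "nat \<Rightarrow> (nat \<Rightarrow> complex) \<Rightarrow> complex"
    where "e j = (\<lambda>s. if bounded (range s) then s j else 0)" for j
  have "\<exists>C. compact C \<and> (\<forall>j. e j s \<in> C)" for s
  proof (cases "bounded (range s)")
    case True
    then have "compact (closure (range s))" by (simp add: compact_closure)
    moreover have "e j s \<in> closure (range s)" for j
      using True closure_subset[of "range s"] by (auto simp: e_def)
    ultimately show ?thesis by blast
  qed (auto simp: e_def intro: exI[of _ "{0}"])
  then obtain C where C: "\<And>s. compact (C s)" "\<And>s j. e j s \<in> C s" by metis
  have "compactin (product_topology (\<lambda>_. euclidean) UNIV) (PiE UNIV C)"
    by (simp add: compactin_PiE C(1))
  then have "compact (PiE UNIV C)" by (simp add: euclidean_product_topology)
  moreover have "\<forall>\<^sub>F p in filtermap e sequentially. p \<in> PiE UNIV C"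
    by (simp add: eventually_filtermap PiE_iff C(2))
  moreover have "filtermap e sequentially \<noteq> bot" by (simp add: filtermap_bot_iff)
  ultimately obtain p where p: "inf (nhds p) (filtermap e sequentially) \<noteq> bot"
    unfolding compact_filter by blast
  define \<F> where "\<F> = inf sequentially (filtercomap e (nhds p))"
  have "\<F> \<noteq> bot"
  proof
    assume "\<F> = bot"
    then have "eventually (\<lambda>_. False) \<F>" by simp
    then obtain P Q where P: "eventually P sequentially" and Q: "eventually Q (filtercomap e (nhds p))"
      and PQ: "\<And>j. P j \<Longrightarrow> Q j \<Longrightarrow> False"
      unfolding \<F>_def eventually_inf by blast
    from Q obtain R where R: "eventually R (nhds p)" "\<And>j. R (e j) \<Longrightarrow> Q j"
      unfolding eventually_filtercomap by blast
    have "eventually (\<lambda>q. \<not> R q) (filtermap e sequentially)"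
      unfolding eventually_filtermap using P by eventually_elim (use R(2) PQ in blast)
    with R(1) have "eventually (\<lambda>_. False) (inf (nhds p) (filtermap e sequentially))"
      unfolding eventually_inf by blast
    with p show False by (simp add: eventually_False)
  qed
  moreover have "(s \<longlongrightarrow> p s) \<F>" if "bounded (range s)" for s
  proof -
    have "filterlim e (nhds p) (filtercomap e (nhds p))" by (rule filterlim_filtercomap)
    then have "(e \<longlongrightarrow> p) \<F>" unfolding \<F>_def by (rule filterlim_mono) auto
    then have "((\<lambda>j. e j s) \<longlongrightarrow> p s) \<F>"
      by (rule continuous_on_tendsto_compose[OF continuous_on_product_coordinates[of s]]) simp_all
    then show ?thesis using that by (simp add: e_def)
  qed
  moreover have "\<F> \<le> sequentially" by (simp add: \<F>_def)
  ultimately show ?thesis by blast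
qed

context group
begin

lemma limit_functional_exists:
  fixes v :: "nat \<Rightarrow> 'a"
  assumes v: "\<And>j. v j \<in> carrier G"
  shows "\<exists>\<phi>\<in>continuous_dual G. \<forall>f c. eventually (\<lambda>j. f (v j) = c) sequentially \<longrightarrow> \<phi> f = c"
proof -
  obtain \<F> where \<F>: "\<F> \<noteq> bot" "\<F> \<le> sequentially"
    and lim: "\<And>s :: nat \<Rightarrow> complex. bounded (range s) \<Longrightarrow> \<exists>l. (s \<longlongrightarrow> l) \<F>"
    using universal_filter_exists by blast
  define \<phi> where "\<phi> f = Lim \<F> (\<lambda>j. f (v j))" for f :: "'a \<Rightarrow> complex"
  have \<phi>I: "\<phi> f = l" if "((\<lambda>j. f (v j)) \<longlongrightarrow> l) \<F>" for f l
    unfolding \<phi>_def by (rule tendsto_Lim[OF \<F>(1) that])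
  have \<phi>: "((\<lambda>j. f (v j)) \<longlongrightarrow> \<phi> f) \<F>" if f: "f \<in> bounded_functions G" for f
  proof -
    have "bounded (range (\<lambda>j. f (v j)))"
      using cmod_le_sup_norm[OF f v] by (auto simp: bounded_iff)
    then obtain l where l: "((\<lambda>j. f (v j)) \<longlongrightarrow> l) \<F>" using lim by blast
    with \<phi>I[OF l] show ?thesis by simp
  qed
  have "\<phi> \<in> continuous_dual G"
    unfolding continuous_dual_def
  proof (intro CollectI conjI ballI allI exI[of _ 1])
    fix f g assume fg: "f \<in> bounded_functions G" "g \<in> bounded_functions G"
    show "\<phi> (\<lambda>z\<in>carrier G. f z + g z) = \<phi> f + \<phi> g"
      using tendsto_add[OF \<phi>[OF fg(1)] \<phi>[OF fg(2)]] by (intro \<phi>I) (simp add: v)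
  next
    fix f c assume f: "f \<in> bounded_functions G"
    show "\<phi> (\<lambda>z\<in>carrier G. c * f z) = c * \<phi> f"
      using tendsto_mult_left[OF \<phi>[OF f], of c] by (intro \<phi>I) (simp add: v)
  next
    fix f assume f: "f \<in> bounded_functions G"
    have "cmod (\<phi> f) \<le> sup_norm G f"
      by (rule tendsto_upperbound[OF tendsto_norm[OF \<phi>[OF f]] always_eventually \<F>(1)])
        (simp add: cmod_le_sup_norm[OF f v])
    then show "cmod (\<phi> f) \<le> 1 * sup_norm G f" by simp
  qed
  moreover have "\<phi> f = c" if "eventually (\<lambda>j. f (v j) = c) sequentially" for f c
    using \<F>(2) that by (intro \<phi>I tendsto_eventually) (rule filter_leD)
  ultimately show ?thesis by blast
qed

section \<open>Indicator functions of sparse sets\<close>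

text \<open>
  Left translation by \<open>x\<close> turns the indicator of \<open>A\<close> into that of \<open>x\<^sup>-\<^sup>1 A\<close>. These
  sets are almost disjoint by the hypothesis on \<open>A \<inter> t A\<close>, and \<open>x\<^sup>-\<^sup>1 A\<close> contains both
  \<open>g\<close> and \<open>h\<close> only if \<open>x g\<close> lies in \<open>A \<inter> A (h\<^sup>-\<^sup>1 g)\<close>.
\<close>

lemma indicator_in_WAP:
  assumes left: "\<And>t. t \<in> carrier G \<Longrightarrow> t \<noteq> \<one> \<Longrightarrow> finite (A \<inter> (\<lambda>a. t \<otimes> a) ` A)"
    and right: "\<And>t. t \<in> carrier G \<Longrightarrow> t \<noteq> \<one> \<Longrightarrow> finite (A \<inter> (\<lambda>a. a \<otimes> t) ` A)"
  shows "ind A \<in> WAP G"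
proof -
  define D where "D x = {z \<in> carrier G. x \<otimes> z \<in> A}" for x
  have translate: "left_translate G x (ind A) = ind (D x)" if "x \<in> carrier G" for x
    using that by (intro ext) (simp add: left_translate_def ind_def D_def)
  have "almost_disjoint (D ` carrier G)"
    unfolding almost_disjoint_def
  proof (intro ballI impI)
    fix B C assume "B \<in> D ` carrier G" "C \<in> D ` carrier G" "B \<noteq> C"
    then obtain x y where xy: "x \<in> carrier G" "y \<in> carrier G" "B = D x" "C = D y" "x \<noteq> y" by blast
    define t where "t = x \<otimes> inv y"
    have t: "t \<in> carrier G" "t \<noteq> \<one>"
      using xy by (auto simp: t_def) (metis inv_closed inv_inv inv_equality)
    have "B \<inter> C \<subseteq> (\<lambda>a. inv x \<otimes> a) ` (A \<inter> (\<lambda>a. t \<otimes> a) ` A)"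
    proof
      fix z assume "z \<in> B \<inter> C"
      then have z: "z \<in> carrier G" "x \<otimes> z \<in> A" "y \<otimes> z \<in> A" using xy by (auto simp: D_def)
      have "x \<otimes> z = t \<otimes> (y \<otimes> z)" "z = inv x \<otimes> (x \<otimes> z)"
        using xy z(1) by (simp_all add: t_def m_assoc inv_solve_left inv_solve_left')
      with z show "z \<in> (\<lambda>a. inv x \<otimes> a) ` (A \<inter> (\<lambda>a. t \<otimes> a) ` A)" by blast
    qed
    then show "finite (B \<inter> C)" by (rule finite_subset) (intro finite_imageI left t)
  qed
  moreover have "finite {B \<in> D ` carrier G. g \<in> B \<and> h \<in> B}" if "g \<noteq> h" for g h
  proof (cases "g \<in> carrier G \<and> h \<in> carrier G")
    case True
    define t where "t = inv h \<otimes> g"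
    have t: "t \<in> carrier G" "t \<noteq> \<one>"
      using True that by (auto simp: t_def) (metis inv_closed inv_inv inv_equality)
    have "{B \<in> D ` carrier G. g \<in> B \<and> h \<in> B} \<subseteq> (\<lambda>a. D (a \<otimes> inv g)) ` (A \<inter> (\<lambda>a. a \<otimes> t) ` A)"
    proof
      fix B assume "B \<in> {B \<in> D ` carrier G. g \<in> B \<and> h \<in> B}"
      then obtain x where x: "x \<in> carrier G" "B = D x" "x \<otimes> g \<in> A" "x \<otimes> h \<in> A"
        by (auto simp: D_def)
      have "x \<otimes> g = (x \<otimes> h) \<otimes> t" "x = (x \<otimes> g) \<otimes> inv g"
        using x(1) True by (simp_all add: t_def m_assoc) (simp flip: m_assoc)
      then have "x \<otimes> g \<in> A \<inter> (\<lambda>a. a \<otimes> t) ` A" "B = D ((x \<otimes> g) \<otimes> inv g)"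
        using x by auto
      then show "B \<in> (\<lambda>a. D (a \<otimes> inv g)) ` (A \<inter> (\<lambda>a. a \<otimes> t) ` A)"
        by (rule rev_image_eqI)
    qed
    then show ?thesis by (rule finite_subset) (intro finite_imageI right t)
  next
    case False
    then have "{B \<in> D ` carrier G. g \<in> B \<and> h \<in> B} = {}" by (auto simp: D_def)
    then show ?thesis by (simp only: finite.emptyI)
  qed
  ultimately have "compactin (weak_topology G)
      (insert (ind {}) (range (\<lambda>g. ind {g}) \<union> ind ` D ` carrier G))"
    by (rule compactin_indicators)
  moreover have "left_orbit G (ind A) \<subseteq> ind ` D ` carrier G"
    using translate by (auto simp: left_orbit_def)
  ultimately show ?thesis
    unfolding WAP_def relatively_weakly_compact_iff using ind_bounded by blast
qed

text \<open>
  The case \<open>i = j\<close> makes the sequence injective. The condition on each \<open>v k\<close> refers only to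
  the earlier terms and excludes finitely many values, so it can be met recursively.
\<close>

definition triple_product_free :: "(nat \<Rightarrow> 'a) \<Rightarrow> bool" where
  "triple_product_free v \<longleftrightarrow> (\<forall>i j l k. i < k \<longrightarrow> j < k \<longrightarrow> l < k \<longrightarrow> v k \<noteq> v i \<otimes> inv (v j) \<otimes> v l)"

text \<open>
  Let \<open>v i = t v j\<close> and \<open>v p = t v q\<close>. If one index exceeded all the others, then
  eliminating \<open>t\<close> would write the corresponding term as a forbidden product. Since
  \<open>p \<noteq> q\<close>, neither \<open>p\<close> nor \<open>q\<close> can exceed the maximum of \<open>i\<close> and
  \<open>j\<close>.
\<close>

lemma triple_product_free_finite_intersections:
  assumes v: "\<And>j. v j \<in> carrier G" and free: "triple_product_free v"
    and t: "t \<in> carrier G" "t \<noteq> \<one>"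
  shows "finite (range v \<inter> (\<lambda>a. t \<otimes> a) ` range v)" "finite (range v \<inter> (\<lambda>a. a \<otimes> t) ` range v)"
proof -
  have no: False if "v k = v i \<otimes> inv (v j) \<otimes> v l" "i < k" "j < k" "l < k" for i j k l
    using free that unfolding triple_product_free_def by blast
  show "finite (range v \<inter> (\<lambda>a. t \<otimes> a) ` range v)"
  proof (cases "\<exists>i j. v i = t \<otimes> v j")
    case True
    then obtain i j where ij: "v i = t \<otimes> v j" by blast
    have t1: "t = v i \<otimes> inv (v j)" and t2: "inv t = v j \<otimes> inv (v i)"
      using ij v t by (simp_all add: inv_mult_group m_assoc) (simp flip: m_assoc)
    have "p \<le> max i j" if pq: "v p = t \<otimes> v q" for p q
    proof (rule ccontr)
      assume p: "\<not> p \<le> max i j"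
      have "p \<noteq> q" using pq v t by auto
      moreover have "v p = v i \<otimes> inv (v j) \<otimes> v q" using pq t1 by simp
      moreover have "v q = v j \<otimes> inv (v i) \<otimes> v p"
        unfolding t2[symmetric] using pq v t by (simp flip: m_assoc)
      ultimately show False using no[of p i j q] no[of q j i p] p by linarith
    qed
    then have "range v \<inter> (\<lambda>a. t \<otimes> a) ` range v \<subseteq> v ` {..max i j}" by auto
    then show ?thesis by (rule finite_subset) simp
  next
    case False
    then have "range v \<inter> (\<lambda>a. t \<otimes> a) ` range v = {}" by auto
    then show ?thesis by simp
  qed
  show "finite (range v \<inter> (\<lambda>a. a \<otimes> t) ` range v)"
  proof (cases "\<exists>i j. v i = v j \<otimes> t")
    case True
    then obtain i j where ij: "v i = v j \<otimes> t" by blast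
    have t1: "t = inv (v j) \<otimes> v i" and t2: "inv t = inv (v i) \<otimes> v j"
      using ij v t by (simp_all add: inv_mult_group m_assoc) (simp_all flip: m_assoc)
    have "p \<le> max i j" if pq: "v p = v q \<otimes> t" for p q
    proof (rule ccontr)
      assume p: "\<not> p \<le> max i j"
      have "p \<noteq> q" using pq v t by auto
      moreover have "v p = v q \<otimes> inv (v j) \<otimes> v i" using pq t1 v by (simp add: m_assoc)
      moreover have "v q = v p \<otimes> inv (v i) \<otimes> v j"
        using pq v t t2 by (metis inv_solve_right inv_closed m_assoc m_closed)
      ultimately show False using no[of p q j i] no[of q p i j] p by linarith
    qed
    then have "range v \<inter> (\<lambda>a. a \<otimes> t) ` range v \<subseteq> v ` {..max i j}" by auto
    then show ?thesis by (rule finite_subset) simp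
  next
    case False
    then have "range v \<inter> (\<lambda>a. a \<otimes> t) ` range v = {}" by auto
    then show ?thesis by simp
  qed
qed

text \<open>
  Let \<open>h n\<close> be the conjugate of the indicator by \<open>a n\<close>, so that \<open>h n (v j) = 1\<close>
  exactly if \<open>j < n\<close>. A generalized limit \<open>\<phi>\<close> along \<open>v\<close> kills every
  \<open>h n\<close>, but equals \<open>1\<close> at every function that is \<open>1\<close> on all \<open>v j\<close>. Hence
  the weakly open sets \<open>{f. \<phi> f \<noteq> 0}\<close> and \<open>{f. f (v j) \<noteq> 1}\<close> cover all bounded
  functions, while any finitely many of them miss \<open>h n\<close> for large \<open>n\<close>.
\<close>

lemma indicator_notin_WS:
  fixes v a :: "nat \<Rightarrow> 'a"
  assumes v: "\<And>j. v j \<in> carrier G" and a: "\<And>n. a n \<in> carrier G"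
    and in_A: "\<And>n j. j < n \<Longrightarrow> a n \<otimes> v j \<otimes> inv (a n) \<in> A"
    and notin_A: "\<And>n j. n \<le> j \<Longrightarrow> a n \<otimes> v j \<otimes> inv (a n) \<notin> A"
  shows "ind A \<notin> WS G"
proof
  assume "ind A \<in> WS G"
  then obtain K where K: "compactin (weak_topology G) K" "double_orbit G (ind A) \<subseteq> K"
    unfolding WS_def relatively_weakly_compact_iff by blast
  define h where "h n = two_sided_translate G (a n) (inv (a n)) (ind A)" for n
  have hK: "h n \<in> K" for n using K(2) a unfolding h_def double_orbit_def by blast
  have h: "h n (v j) = (if j < n then 1 else 0)" for n j
    using v a in_A[of j n] notin_A[of n j]
    by (cases "j < n") (simp_all add: h_def two_sided_translate_def ind_def not_less)
  obtain \<phi> where \<phi>: "\<phi> \<in> continuous_dual G"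
    and lim: "\<And>f c. eventually (\<lambda>j. f (v j) = c) sequentially \<Longrightarrow> \<phi> f = c"
    using limit_functional_exists[of v, OF v] by blast
  have \<phi>h: "\<phi> (h n) = 0" for n
    by (intro lim eventually_mono[OF eventually_ge_at_top[of n]]) (simp add: h)
  define V where "V j = {f \<in> bounded_functions G. f (v j) \<in> - {1}}" for j
  define W where "W = {f \<in> bounded_functions G. \<phi> f \<in> - {0}}"
  have "openin (weak_topology G) W"
    unfolding W_def by (rule openin_weak_preimage[OF \<phi>]) (intro open_Compl closed_singleton)
  moreover have "openin (weak_topology G) (V j)" for j
    unfolding V_def by (rule openin_weak_preimage[OF evaluation_in_dual[OF v]]) (intro open_Compl closed_singleton)
  ultimately have "openin (weak_topology G) U" if "U \<in> insert W (range V)" for U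
    using that by blast
  moreover have "K \<subseteq> \<Union>(insert W (range V))"
  proof
    fix f assume "f \<in> K"
    then have f: "f \<in> bounded_functions G"
      using K(1) compactin_subset_topspace topspace_weak_topology by blast
    show "f \<in> \<Union>(insert W (range V))"
    proof (cases "\<forall>j. f (v j) = 1")
      case True
      then have "\<phi> f = 1" by (intro lim) simp
      with f show ?thesis by (simp add: W_def)
    next
      case False
      with f show ?thesis by (auto simp: V_def)
    qed
  qed
  ultimately obtain \<V> where \<V>: "finite \<V>" "\<V> \<subseteq> insert W (range V)" "K \<subseteq> \<Union>\<V>"
    using K(1) unfolding compactin_def by meson
  have "finite (\<V> - {W})" "\<V> - {W} \<subseteq> range V" using \<V> by auto
  then obtain J where J: "finite J" "\<V> - {W} = V ` J"
    by (meson finite_subset_image)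
  obtain n where n: "\<And>j. j \<in> J \<Longrightarrow> j < n"
    using J(1) unfolding finite_nat_set_iff_bounded by blast
  have "h n \<notin> W" using \<phi>h by (simp add: W_def)
  moreover have "h n \<notin> V j" if "j \<in> J" for j using n[OF that] h by (simp add: V_def)
  ultimately have "h n \<notin> \<Union>\<V>" using J(2) by blast
  then show False using hK \<V>(3) by blast
qed

section \<open>Centralizers in groups with finite conjugacy classes\<close>

definition centralizer :: "'a set \<Rightarrow> 'a set" where
  "centralizer S = {g \<in> carrier G. \<forall>s\<in>S. g \<otimes> s = s \<otimes> g}"

text \<open>
  The coset of \<open>g\<close> modulo the centralizer is determined by the conjugates
  \<open>g\<^sup>-\<^sup>1 s g\<close> of the members \<open>s\<close> of \<open>S\<close>, and each of these can take only
  finitely many values.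
\<close>

lemma centralizer_finite_transversal:
  assumes FC: "FC_group G" and S: "finite S" "S \<subseteq> carrier G"
  shows "\<exists>T. finite T \<and> T \<subseteq> carrier G \<and> (\<forall>g\<in>carrier G. \<exists>t\<in>T. g \<otimes> inv t \<in> centralizer S)"
proof -
  define \<kappa> where "\<kappa> g = (\<lambda>s\<in>S. inv g \<otimes> s \<otimes> g)" for g
  have "\<kappa> ` carrier G \<subseteq> PiE S (conjugacy_class G)"
  proof
    fix k assume "k \<in> \<kappa> ` carrier G"
    then obtain g where g: "g \<in> carrier G" "k = \<kappa> g" by blast
    have "inv g \<otimes> s \<otimes> g \<in> conjugacy_class G s" for s
      unfolding conjugacy_class_def using g(1) by (intro CollectI exI[of _ "inv g"]) simp
    then show "k \<in> PiE S (conjugacy_class G)" using g(2) by (auto simp: \<kappa>_def)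
  qed
  moreover have "finite (PiE S (conjugacy_class G))"
    using FC S by (intro finite_PiE) (auto simp: FC_group_def)
  ultimately have "finite (\<kappa> ` carrier G)" by (rule finite_subset)
  then obtain T where T: "T \<subseteq> carrier G" "finite T" "\<kappa> ` carrier G = \<kappa> ` T"
    using finite_subset_image[of "\<kappa> ` carrier G" \<kappa> "carrier G"] by auto
  have "\<exists>t\<in>T. g \<otimes> inv t \<in> centralizer S" if g: "g \<in> carrier G" for g
  proof -
    obtain t where t: "t \<in> T" "\<kappa> g = \<kappa> t" using T(3) g by (metis imageE imageI)
    then have tG: "t \<in> carrier G" using T by blast
    have "g \<otimes> inv t \<otimes> s = s \<otimes> (g \<otimes> inv t)" if s: "s \<in> S" for s
    proof -
      have sG: "s \<in> carrier G" using s S by blast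
      have eq: "inv g \<otimes> s \<otimes> g = inv t \<otimes> s \<otimes> t" using t(2) s by (metis \<kappa>_def restrict_apply')
      have "s \<otimes> g = g \<otimes> (inv g \<otimes> s \<otimes> g)" using g sG by (simp flip: m_assoc)
      also have "\<dots> = g \<otimes> inv t \<otimes> s \<otimes> t" unfolding eq using g tG sG by (simp add: m_assoc)
      finally have "s \<otimes> g \<otimes> inv t = g \<otimes> inv t \<otimes> s \<otimes> t \<otimes> inv t" by simp
      then show ?thesis using g tG sG by (simp add: m_assoc)
    qed
    then show ?thesis using t(1) g tG by (auto simp: centralizer_def)
  qed
  then show ?thesis using T by blast
qed

lemma finite_rcosets_iff:
  assumes H: "subgroup H G"
  shows "finite (rcosets H) \<longleftrightarrow>
    (\<exists>T. finite T \<and> T \<subseteq> carrier G \<and> (\<forall>g\<in>carrier G. \<exists>t\<in>T. g \<otimes> inv t \<in> H))"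
proof
  have rc: "rcosets H = (\<lambda>g. H #> g) ` carrier G" by (auto simp: RCOSETS_def)
  assume "finite (rcosets H)"
  then obtain T where T: "T \<subseteq> carrier G" "finite T" "(\<lambda>g. H #> g) ` carrier G = (\<lambda>g. H #> g) ` T"
    unfolding rc using finite_subset_image[of "(\<lambda>g. H #> g) ` carrier G" "\<lambda>g. H #> g" "carrier G"]
    by auto
  have "\<exists>t\<in>T. g \<otimes> inv t \<in> H" if g: "g \<in> carrier G" for g
  proof -
    obtain t where t: "t \<in> T" "H #> g = H #> t" using T(3) g by (metis (no_types, lifting) imageE imageI)
    then have "g \<in> H #> t" using rcos_self[OF g H] by simp
    then obtain x where x: "x \<in> H" "g = x \<otimes> t" by (auto simp: r_coset_def)
    then have "g \<otimes> inv t = x" using t T(1) subgroup.subset[OF H] by (auto simp: m_assoc subset_iff)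
    with x(1) have "g \<otimes> inv t \<in> H" by simp
    with t(1) show ?thesis by blast
  qed
  with T(1,2) show "\<exists>T. finite T \<and> T \<subseteq> carrier G \<and> (\<forall>g\<in>carrier G. \<exists>t\<in>T. g \<otimes> inv t \<in> H)"
    by (intro exI[of _ T]) simp
next
  assume "\<exists>T. finite T \<and> T \<subseteq> carrier G \<and> (\<forall>g\<in>carrier G. \<exists>t\<in>T. g \<otimes> inv t \<in> H)"
  then obtain T where T: "finite T" "T \<subseteq> carrier G" "\<And>g. g \<in> carrier G \<Longrightarrow> \<exists>t\<in>T. g \<otimes> inv t \<in> H"
    by blast
  have "rcosets H \<subseteq> (\<lambda>t. H #> t) ` T"
  proof
    fix R assume "R \<in> rcosets H"
    then obtain g where g: "g \<in> carrier G" "R = H #> g" by (auto simp: RCOSETS_def)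
    then obtain t where t: "t \<in> T" "g \<otimes> inv t \<in> H" using T(3) by blast
    have "g = (g \<otimes> inv t) \<otimes> t" using g t T(2) by (auto simp: m_assoc subset_iff)
    then have "g \<in> H #> t" using t(2) by (auto simp: r_coset_def)
    then have "H #> t = H #> g" using t T(2) H by (intro repr_independence) auto
    then show "R \<in> (\<lambda>t. H #> t) ` T" using g t by blast
  qed
  then show "finite (rcosets H)" by (rule finite_subset) (simp add: T(1))
qed

text \<open>
  Suppose that the centralizer of \<open>S\<close> is commutative and let \<open>T\<close> be a finite transversal of
  it. An element that commutes with \<open>S\<close> and with \<open>T\<close> then commutes with the centralizer of
  \<open>S\<close> and with \<open>T\<close>, and these generate the group. So the center contains the centralizer
  of the finite set \<open>S \<union> T\<close>, which has finite index.
\<close>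

lemma noncommuting_in_centralizer:
  assumes FC: "FC_group G" and inf: "infinite (rcosets (center G))"
    and S: "finite S" "S \<subseteq> carrier G"
  shows "\<exists>a\<in>centralizer S. \<exists>b\<in>centralizer S. a \<otimes> b \<noteq> b \<otimes> a"
proof (rule ccontr)
  assume "\<not> ?thesis"
  then have comm: "\<And>a b. a \<in> centralizer S \<Longrightarrow> b \<in> centralizer S \<Longrightarrow> a \<otimes> b = b \<otimes> a" by blast
  obtain T where T: "finite T" "T \<subseteq> carrier G" "\<And>g. g \<in> carrier G \<Longrightarrow> \<exists>t\<in>T. g \<otimes> inv t \<in> centralizer S"
    using centralizer_finite_transversal[OF FC S] by blast
  have "centralizer (S \<union> T) \<subseteq> center G"
  proof
    fix z assume z: "z \<in> centralizer (S \<union> T)"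
    then have zG: "z \<in> carrier G" and zS: "z \<in> centralizer S" by (auto simp: centralizer_def)
    have "z \<otimes> g = g \<otimes> z" if g: "g \<in> carrier G" for g
    proof -
      obtain t where t: "t \<in> T" "g \<otimes> inv t \<in> centralizer S" using T(3) g by blast
      define h where "h = g \<otimes> inv t"
      have tG: "t \<in> carrier G" and hG: "h \<in> carrier G" using t T(2) g by (auto simp: h_def)
      have zt: "z \<otimes> t = t \<otimes> z" using z t(1) by (auto simp: centralizer_def)
      have zh: "z \<otimes> h = h \<otimes> z" using comm[OF zS] t(2) by (simp add: h_def)
      have "g = h \<otimes> t" using g tG by (simp add: h_def m_assoc)
      then show ?thesis using zt zh zG tG hG by (metis m_assoc)
    qed
    then show "z \<in> center G" using zG by (simp add: center_def)
  qed
  moreover obtain U where U: "finite U" "U \<subseteq> carrier G"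
    "\<And>g. g \<in> carrier G \<Longrightarrow> \<exists>t\<in>U. g \<otimes> inv t \<in> centralizer (S \<union> T)"
    using centralizer_finite_transversal[OF FC, of "S \<union> T"] S T(1,2) by auto
  ultimately have "\<forall>g\<in>carrier G. \<exists>t\<in>U. g \<otimes> inv t \<in> center G"
    by (meson subsetD)
  then have "finite (rcosets (center G))"
    unfolding finite_rcosets_iff[OF subgroup_center] using U(1,2) by (intro exI[of _ U]) simp
  with inf show False by blast
qed

text \<open>
  Every step picks two elements \<open>a'\<close> and \<open>b\<close> that do not commute from the centralizer of
  all elements seen so far, and multiplies \<open>w\<close> by \<open>b\<close>. Then \<open>a'\<close> commutes with the old
  \<open>w\<close> but not with the new one; later factors commute with \<open>a'\<close> and cannot restore
  commutation.
\<close>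

lemma staircase_of_commutators:
  assumes FC: "FC_group G" and inf: "infinite (rcosets (center G))"
  obtains a w :: "nat \<Rightarrow> 'a" where "\<And>n. a n \<in> carrier G" "\<And>n. w n \<in> carrier G"
    "\<And>n m. a n \<otimes> w m = w m \<otimes> a n \<longleftrightarrow> m < n"
proof -
  \<comment> \<open>The states of the recursion: \<open>S\<close> collects the elements seen so far.\<close>
  define P where "P = (\<lambda>(S, a, w). finite S \<and> S \<subseteq> carrier G \<and> a \<in> S \<and> w \<in> S \<and> a \<otimes> w \<noteq> w \<otimes> a)"
  define Q where "Q = (\<lambda>(S, a :: 'a, w) (S', a', w'). S \<subseteq> S' \<and> a' \<in> centralizer S \<and>
    (\<exists>b\<in>centralizer S. w' = w \<otimes> b))"
  have "\<exists>f :: nat \<Rightarrow> _. \<forall>n. P (f n) \<and> Q (f n) (f (Suc n))"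
  proof (rule dependent_nat_choice[of "\<lambda>_. P" "\<lambda>_. Q"])
    obtain a b where "a \<in> centralizer {}" "b \<in> centralizer {}" "a \<otimes> b \<noteq> b \<otimes> a"
      using noncommuting_in_centralizer[OF FC inf, of "{}"] by auto
    then show "\<exists>x. P x" by (intro exI[of _ "({a, b}, a, b)"]) (simp add: P_def centralizer_def)
  next
    fix x and n :: nat assume "P x"
    then obtain S a w where x: "x = (S, a, w)" and S: "finite S" "S \<subseteq> carrier G" "w \<in> S"
      by (cases x) (auto simp: P_def)
    obtain a' b where ab: "a' \<in> centralizer S" "b \<in> centralizer S" "a' \<otimes> b \<noteq> b \<otimes> a'"
      using noncommuting_in_centralizer[OF FC inf S(1,2)] by blast
    have G: "a' \<in> carrier G" "b \<in> carrier G" "w \<in> carrier G" and a'w: "a' \<otimes> w = w \<otimes> a'"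
      using ab S by (auto simp: centralizer_def)
    have "a' \<otimes> (w \<otimes> b) = w \<otimes> (a' \<otimes> b)" using G a'w by (metis m_assoc)
    moreover have "(w \<otimes> b) \<otimes> a' = w \<otimes> (b \<otimes> a')" using G by (simp add: m_assoc)
    ultimately have "a' \<otimes> (w \<otimes> b) \<noteq> (w \<otimes> b) \<otimes> a'" using G ab(3) by simp
    then have "P (insert a' (insert (w \<otimes> b) S), a', w \<otimes> b)" using S G by (simp add: P_def)
    moreover have "Q x (insert a' (insert (w \<otimes> b) S), a', w \<otimes> b)"
      unfolding x Q_def using ab by blast
    ultimately show "\<exists>y. P y \<and> Q x y" by blast
  qed
  then obtain f where f: "\<And>n. P (f n)" "\<And>n. Q (f n) (f (Suc n))" by blast
  define S a w where "S n = fst (f n)" and "a n = fst (snd (f n))" and "w n = snd (snd (f n))" for n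
  have f_eq: "f n = (S n, a n, w n)" for n by (simp add: S_def a_def w_def)
  have PS: "S n \<subseteq> carrier G" "a n \<in> S n" "w n \<in> S n" "a n \<otimes> w n \<noteq> w n \<otimes> a n" for n
    using f(1)[of n] by (auto simp: P_def f_eq)
  have QS: "S n \<subseteq> S (Suc n)" "a (Suc n) \<in> centralizer (S n)"
    "\<exists>b\<in>centralizer (S n). w (Suc n) = w n \<otimes> b" for n
    using f(2)[of n] by (auto simp: Q_def f_eq)
  have G: "a n \<in> carrier G" "w n \<in> carrier G" for n using PS by auto
  have mono: "S m \<subseteq> S n" if "m \<le> n" for m n using lift_Suc_mono_le[of S] QS(1) that by blast
  have "a n \<otimes> w m = w m \<otimes> a n" if "m < n" for m n
  proof -
    obtain k where k: "n = Suc k" "m \<le> k" using \<open>m < n\<close> by (cases n) auto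
    then have "w m \<in> S k" using PS(3) mono by blast
    then show ?thesis using QS(2)[of k] k(1) by (auto simp: centralizer_def)
  qed
  moreover have "a n \<otimes> w m \<noteq> w m \<otimes> a n" if "n \<le> m" for m n
    using that
  proof (induction m rule: dec_induct)
    case base
    show ?case by (rule PS(4))
  next
    case (step m)
    obtain b where b: "b \<in> centralizer (S m)" "w (Suc m) = w m \<otimes> b" using QS(3) by blast
    have bG: "b \<in> carrier G" using b(1) by (simp add: centralizer_def)
    have "a n \<in> S m" using PS(2) mono step.hyps by blast
    then have ab: "a n \<otimes> b = b \<otimes> a n" using b(1) by (auto simp: centralizer_def)
    have "a n \<otimes> w (Suc m) = (a n \<otimes> w m) \<otimes> b" using b(2) bG G by (simp add: m_assoc)
    moreover have "w (Suc m) \<otimes> a n = (w m \<otimes> a n) \<otimes> b"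
      using b(2) bG G ab by (simp add: m_assoc)
    ultimately show ?case using step.IH bG G by simp
  qed
  ultimately show thesis using that[of a w] G by (meson not_le)
qed

lemma triple_product_free_subsequence:
  assumes FC: "FC_group G" and w: "\<And>n. w n \<in> carrier G" and inj: "inj w"
  obtains m :: "nat \<Rightarrow> nat" where "strict_mono m" "triple_product_free (w \<circ> m)"
    "\<And>i k. i < k \<Longrightarrow> w (m k) \<notin> conjugacy_class G (w (m i))"
proof -
  \<comment> \<open>The next index must exceed \<open>n\<close> and lead to an element outside \<open>B n\<close>. Since all indices up to
    \<open>n\<close> contribute to \<open>B n\<close>, it is enough to remember the index chosen last.\<close>
  define B where "B n = (\<lambda>(x, y, z). w x \<otimes> inv (w y) \<otimes> w z) ` ({..n} \<times> {..n} \<times> {..n}) \<union>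
    (\<Union>i\<le>n. conjugacy_class G (w i))" for n
  have B: "finite (B n)" for n using FC w by (auto simp: B_def FC_group_def)
  have B_mono: "B p \<subseteq> B n" if "p \<le> n" for p n
    unfolding B_def using that by (intro Un_mono image_mono Sigma_mono UN_mono) auto
  have "\<exists>m. \<forall>n. True \<and> m n < m (Suc n) \<and> w (m (Suc n)) \<notin> B (m n)"
  proof (rule dependent_nat_choice[of "\<lambda>_ _. True" "\<lambda>_ x y. x < y \<and> w y \<notin> B x"])
    fix x n :: nat
    have "infinite (w ` {x<..})" using inj by (simp add: finite_image_iff inj_on_subset infinite_Ioi)
    then have "\<not> w ` {x<..} \<subseteq> B x" using B finite_subset by blast
    then show "\<exists>y. True \<and> x < y \<and> w y \<notin> B x" by auto
  qed simp
  then obtain m where m: "\<And>n. m n < m (Suc n)" "\<And>n. w (m (Suc n)) \<notin> B (m n)" by blast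
  have sm: "strict_mono m" using m(1) by (simp add: strict_mono_Suc_iff)
  have avoid: "w (m k) \<notin> B (m i)" if "i < k" for i k
  proof -
    obtain n where n: "k = Suc n" "i \<le> n" using \<open>i < k\<close> by (cases k) auto
    have "B (m i) \<subseteq> B (m n)" using n sm by (intro B_mono) (simp add: strict_mono_less_eq)
    then show ?thesis using m(2)[of n] n(1) by blast
  qed
  have "triple_product_free (w \<circ> m)"
    unfolding triple_product_free_def
  proof (intro allI impI notI)
    fix i j l k assume ijl: "i < k" "j < k" "l < k"
      and eq: "(w \<circ> m) k = (w \<circ> m) i \<otimes> inv ((w \<circ> m) j) \<otimes> (w \<circ> m) l"
    define p where "p = max i (max j l)"
    have "m i \<le> m p" "m j \<le> m p" "m l \<le> m p" "p < k"
      using sm ijl by (auto simp: p_def strict_mono_less_eq)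
    then have "w (m i) \<otimes> inv (w (m j)) \<otimes> w (m l) \<in> B (m p)"
      unfolding B_def by (intro UnI1 image_eqI[of _ _ "(m i, m j, m l)"]) auto
    then show False using avoid[OF \<open>p < k\<close>] eq by simp
  qed
  moreover have "w (m k) \<notin> conjugacy_class G (w (m i))" if "i < k" for i k
    using avoid[OF that] by (auto simp: B_def)
  ultimately show thesis using that sm by blast
qed

section \<open>Comparison of WS and WAP\<close>

lemma WS_subset_WAP: "WS G \<subseteq> WAP G"
proof
  fix f assume "f \<in> WS G"
  moreover have "left_orbit G f \<subseteq> double_orbit G f"
  proof
    fix h assume "h \<in> left_orbit G f"
    then obtain x where x: "x \<in> carrier G" "h = left_translate G x f" by (auto simp: left_orbit_def)
    then have "h = two_sided_translate G x \<one> f"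
      by (intro ext) (simp add: left_translate_def two_sided_translate_def)
    then show "h \<in> double_orbit G f" using x unfolding double_orbit_def by blast
  qed
  ultimately show "f \<in> WAP G" unfolding WS_def WAP_def relatively_weakly_compact_iff by blast
qed

lemma WAP_subset_WS_if_finite_index_center:
  assumes "finite (rcosets (center G))"
  shows "WAP G \<subseteq> WS G"
proof
  fix f assume f: "f \<in> WAP G"
  then obtain K where K: "compactin (weak_topology G) K" "left_orbit G f \<subseteq> K"
    unfolding WAP_def relatively_weakly_compact_iff by blast
  obtain T where T: "finite T" "T \<subseteq> carrier G" "\<And>g. g \<in> carrier G \<Longrightarrow> \<exists>t\<in>T. g \<otimes> inv t \<in> center G"
    using assms unfolding finite_rcosets_iff[OF subgroup_center] by blast
  let ?K = "\<Union>t\<in>T. two_sided_translate G \<one> t ` K"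
  have "compactin (weak_topology G) ?K"
    using T(1,2) K(1) by (intro compactin_Union)
      (auto intro!: image_compactin continuous_map_two_sided_translate)
  moreover have "double_orbit G f \<subseteq> ?K"
  proof
    fix h assume "h \<in> double_orbit G f"
    then obtain x y where xy: "x \<in> carrier G" "y \<in> carrier G" "h = two_sided_translate G x y f"
      by (auto simp: double_orbit_def)
    obtain t where t: "t \<in> T" "y \<otimes> inv t \<in> center G" using T(3) xy(2) by blast
    define c where "c = y \<otimes> inv t"
    have tG: "t \<in> carrier G" and cG: "c \<in> carrier G" using t(1) T(2) xy(2) by (auto simp: c_def)
    have y: "y = c \<otimes> t" using xy tG by (simp add: c_def m_assoc)
    have comm: "c \<otimes> z = z \<otimes> c" if "z \<in> carrier G" for z
      using t(2) that by (simp add: center_def c_def)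
    have "x \<otimes> z \<otimes> y = (x \<otimes> c) \<otimes> (\<one> \<otimes> z \<otimes> t)" if z: "z \<in> carrier G" for z
    proof -
      have "x \<otimes> z \<otimes> y = x \<otimes> (z \<otimes> c) \<otimes> t" unfolding y using xy z tG cG by (simp add: m_assoc)
      also have "\<dots> = x \<otimes> (c \<otimes> z) \<otimes> t" using comm[OF z] by simp
      finally show ?thesis using xy z tG cG by (simp add: m_assoc)
    qed
    then have "h = two_sided_translate G \<one> t (left_translate G (x \<otimes> c) f)"
      unfolding xy(3) using tG by (intro ext) (simp add: two_sided_translate_def left_translate_def)
    moreover have "left_translate G (x \<otimes> c) f \<in> K"
      using K(2) xy(1) cG unfolding left_orbit_def by blast
    ultimately show "h \<in> ?K" using t(1) by blast
  qed
  ultimately show "f \<in> WS G"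
    using f unfolding WS_def WAP_def relatively_weakly_compact_iff by blast
qed

lemma WAP_not_subset_WS_if_infinite_index_center:
  assumes FC: "FC_group G" and inf: "infinite (rcosets (center G))"
  shows "\<not> WAP G \<subseteq> WS G"
proof -
  obtain a w :: "nat \<Rightarrow> 'a" where a: "\<And>n. a n \<in> carrier G" and w: "\<And>n. w n \<in> carrier G"
    and comm: "\<And>n m. a n \<otimes> w m = w m \<otimes> a n \<longleftrightarrow> m < n"
    using staircase_of_commutators[OF FC inf] by blast
  have "inj w" using comm by (intro linorder_injI) (metis less_irrefl)
  then obtain m where m: "strict_mono m" "triple_product_free (w \<circ> m)"
    and conj: "\<And>i k. i < k \<Longrightarrow> w (m k) \<notin> conjugacy_class G (w (m i))"
    using triple_product_free_subsequence[where w = w, OF FC w] by blast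
  define v where "v = w \<circ> m"
  have v: "v j \<in> carrier G" for j using w by (simp add: v_def)
  have comm_v: "a (m n) \<otimes> v j = v j \<otimes> a (m n) \<longleftrightarrow> j < n" for n j
    using comm strict_mono_less[OF m(1)] by (simp add: v_def)
  have conj_v: "v k \<noteq> g \<otimes> v i \<otimes> inv g" if "i \<noteq> k" "g \<in> carrier G" for i k g
  proof
    assume eq: "v k = g \<otimes> v i \<otimes> inv g"
    have "v i = inv g \<otimes> v k \<otimes> inv (inv g)"
      unfolding eq using that(2) v[of i] by (simp add: m_assoc) (simp flip: m_assoc)
    then have "v i \<in> conjugacy_class G (v k)" "v k \<in> conjugacy_class G (v i)"
      using eq that(2) inv_closed unfolding conjugacy_class_def by blast+
    then show False using conj[of i k] conj[of k i] that(1) by (auto simp: v_def neq_iff)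
  qed
  have "ind (range v) \<in> WAP G"
    using v triple_product_free_finite_intersections[OF v] m(2) unfolding v_def[symmetric]
    by (intro indicator_in_WAP) auto
  moreover have "ind (range v) \<notin> WS G"
  proof (rule indicator_notin_WS[where v = v and a = "a \<circ> m"])
    fix n j :: nat assume "j < n"
    then have "a (m n) \<otimes> v j \<otimes> inv (a (m n)) = v j"
      using comm_v[of n j] a v by (simp add: m_assoc)
    then show "(a \<circ> m) n \<otimes> v j \<otimes> inv ((a \<circ> m) n) \<in> range v" by simp
  next
    fix n j :: nat assume "n \<le> j"
    have "a (m n) \<otimes> v j \<otimes> inv (a (m n)) \<noteq> v i" for i
    proof (cases "i = j")
      case True
      have "a (m n) \<otimes> v j \<otimes> inv (a (m n)) = v j \<Longrightarrow> a (m n) \<otimes> v j = v j \<otimes> a (m n)"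
        using a v by (metis inv_solve_right' m_closed)
      then show ?thesis using True comm_v[of n j] \<open>n \<le> j\<close> by auto
    next
      case False
      then show ?thesis using conj_v[of j i "a (m n)"] a by metis
    qed
    then show "(a \<circ> m) n \<otimes> v j \<otimes> inv ((a \<circ> m) n) \<notin> range v" by auto
  qed (use a v in auto)
  ultimately show ?thesis by blast
qed

end

theorem theorem4p4:
  fixes G :: "('a, 'm) monoid_scheme"
  assumes "FC_group G"
  shows "WS_group G \<longleftrightarrow> finite (rcosets\<^bsub>G\<^esub> (center G))"
proof -
  interpret group G using assms by (simp add: FC_group_def)
  show ?thesis
    unfolding WS_group_def
    using WS_subset_WAP WAP_subset_WS_if_finite_index_center
      WAP_not_subset_WS_if_infinite_index_center[OF assms] by blast
qed

end
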